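(* Let $(M,J)$ be a closed connected almost complex $4$-manifold, let $e\in H_2(M;\mathbb Z)$ be a $J$-nef class with $g_J(e)=0$, and let $L=l_e$. If $G$ is a connected curve configuration with total class $e$ and at least $2$ vertices, then the dimension $l_G$ (of the stratum of $\mathcal M_{red,e}$ indexed by $G$) satisfies $$l_G\le L-1 .$$
   Context: A closed set $C\subset M$ with finite, nonzero 2-dimensional Hausdorff measure is an irreducible $J$-holomorphic subvariety if it has no isolated points and if the complement of a finite set of points in $C$ is a connected smooth submanifold with $J$-invariant tangent space. A $J$-holomorphic subvariety $\Theta$ is a finite set of pairs $\{(C_i,m_i)\}$ with the $C_i$ pairwise distinct irreducible subvarieties and $m_i$ positive integers. Each irreducible $C$ is the image of a $J$-holomorphic map $\phi:\Sigma\to M$ from a compact connected complex curve, an embedding off a finite set; $e_C=\phi_*[\Sigma]$, and $e_\Theta=\sum m_ie_{C_i}$ is the class of $\Theta$. A class is $J$-effective if it is the class of some subvariety, and $J$-nef if it pairs non-negatively with every $J$-effective class. $\mathcal M_{red,e}$ is the set of subvarieties in class $e$ that are not irreducible; it is stratified by the underlying weighted graph (vertices weighted by $(e_{C_i},m_i)$). With $K_J$ the canonical class: $adj(e)=e\cdot e+K_J\cdot e$, $g_J(e)=\frac12 adj(e)+1$, $\iota_e=\frac12(e\cdot e-K_J\cdot e)$, $l_e=\max\{\iota_e,0\}$. A weighted graph is a finite graph whose vertices are weighted by pairs $(e_i,m_i)$ with $e_i\in H_2(M;\mathbb Z)$ a $J$-effective class and $m_i$ a positive integer, with an edge between two vertices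 exactly when the intersection number of their classes is nonzero, labelled by that number. Its total class is $\sum_i m_ie_i$. It is a curve configuration if $adj(e_i)\ge -2$ for every vertex and every edge label is positive. For $G$ with vertices weighted by $(e_i,m_i)$, the dimension is $l_G=\sum_i l_{e_i}$. *)

theory Defs
  imports "HOL-Homology.Homology" "HOL-Complex_Analysis.Winding_Numbers"
begin

section \<open>Smooth maps, charts and atlases\<close>

primrec Ck_on :: "nat \<Rightarrow> 'a::real_normed_vector set \<Rightarrow> ('a \<Rightarrow> 'b::real_normed_vector) \<Rightarrow> bool" where
  "Ck_on 0 S f \<longleftrightarrow> continuous_on S f"
| "Ck_on (Suc k) S f \<longleftrightarrow>
     f differentiable_on S \<and> (\<forall>v. Ck_on k S (\<lambda>x. frechet_derivative f (at x) v))"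

text \<open>Only used for open subsets of finite-dimensional spaces.\<close>

definition smooth_on :: "'a::real_normed_vector set \<Rightarrow> ('a \<Rightarrow> 'b::real_normed_vector) \<Rightarrow> bool" where
  "smooth_on S f \<longleftrightarrow> (\<forall>k. Ck_on k S f)"

text \<open>A chart is a pair of its domain and a coordinate map; the values of the coordinate
  map off the domain are irrelevant.\<close>

type_synonym ('a, 'e) chart = "'a set \<times> ('a \<Rightarrow> 'e)"

definition is_chart :: "'a topology \<Rightarrow> ('a, 'e::euclidean_space) chart \<Rightarrow> bool" where
  "is_chart X c \<longleftrightarrow> openin X (fst c) \<and> open (snd c ` fst c) \<and>
     homeomorphic_map (subtopology X (fst c)) (top_of_set (snd c ` fst c)) (snd c)"

definition chart_inv :: "('a, 'e) chart \<Rightarrow> 'e \<Rightarrow> 'a" where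
  "chart_inv c = inv_into (fst c) (snd c)"

definition coord_change :: "('a, 'e) chart \<Rightarrow> ('a, 'e) chart \<Rightarrow> 'e \<Rightarrow> 'e" where
  "coord_change c c' = snd c' \<circ> chart_inv c"

definition smooth_compatible ::
    "('a, 'e::euclidean_space) chart \<Rightarrow> ('a, 'e) chart \<Rightarrow> bool" where
  "smooth_compatible c c' \<longleftrightarrow>
     smooth_on (snd c ` (fst c \<inter> fst c')) (coord_change c c') \<and>
     smooth_on (snd c' ` (fst c \<inter> fst c')) (coord_change c' c)"

definition smooth_structure :: "'a topology \<Rightarrow> ('a, 'e::euclidean_space) chart set \<Rightarrow> bool" where
  "smooth_structure X \<A> \<longleftrightarrow>
     (\<forall>c\<in>\<A>. is_chart X c) \<and> (\<Union>c\<in>\<A>. fst c) = topspace X \<and>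
     (\<forall>c\<in>\<A>. \<forall>c'\<in>\<A>. smooth_compatible c c') \<and>
     (\<forall>c. is_chart X c \<and> (\<forall>c'\<in>\<A>. smooth_compatible c c') \<longrightarrow> c \<in> \<A>)"

section \<open>Almost complex 4-manifolds\<close>

text \<open>The almost complex structure is given by its local expressions: \<open>acs X c x\<close> is the
  endomorphism of \<open>real^4\<close> that represents it at the point with coordinates \<open>x\<close> in the
  chart \<open>c\<close>.\<close>

record 'a almost_complex =
  actop :: "'a topology"
  atlas :: "('a, real^4) chart set"
  acs :: "('a, real^4) chart \<Rightarrow> real^4 \<Rightarrow> real^4 \<Rightarrow> real^4"

definition almost_complex_structure :: "'a almost_complex \<Rightarrow> bool" where
  "almost_complex_structure X \<longleftrightarrow>
     (\<forall>c\<in>atlas X. \<forall>v. smooth_on (snd c ` fst c) (\<lambda>x. acs X c x v)) \<and>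
     (\<forall>c\<in>atlas X. \<forall>x\<in>snd c ` fst c. linear (acs X c x) \<and> (\<forall>v. acs X c x (acs X c x v) = - v)) \<and>
     (\<forall>c\<in>atlas X. \<forall>c'\<in>atlas X. \<forall>x\<in>snd c ` (fst c \<inter> fst c'). \<forall>v.
        frechet_derivative (coord_change c c') (at x) (acs X c x v) =
        acs X c' (coord_change c c' x) (frechet_derivative (coord_change c c') (at x) v))"

text \<open>Second countability is automatic, since the space is compact and locally Euclidean.\<close>

definition closed_connected_almost_complex_4_manifold :: "'a almost_complex \<Rightarrow> bool" where
  "closed_connected_almost_complex_4_manifold X \<longleftrightarrow>
     topspace (actop X) \<noteq> {} \<and> compact_space (actop X) \<and> Hausdorff_space (actop X) \<and>
     connected_space (actop X) \<and>
     smooth_structure (actop X) (atlas X) \<and> almost_complex_structure X"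

section \<open>Fundamental classes\<close>

text \<open>The affine simplex with vertices \<open>v 0, \<dots>, v n\<close> in the coordinates of \<open>c\<close>, as a singular
  simplex of the manifold.\<close>

definition chart_simplex ::
    "('a, 'e::euclidean_space) chart \<Rightarrow> nat \<Rightarrow> (nat \<Rightarrow> 'e) \<Rightarrow> (nat \<Rightarrow> real) \<Rightarrow> 'a" where
  "chart_simplex c n v =
     restrict (\<lambda>t. chart_inv c (\<Sum>j\<le>n. t j *\<^sub>R v j)) (standard_simplex n)"

text \<open>\<open>pos c x v\<close> says that the affine simplex with vertices \<open>v 0, \<dots>, v n\<close> is positively
  oriented for the orientation at the point with coordinates \<open>x\<close> in the chart \<open>c\<close>. The
  fundamental class is the class that restricts at every point \<open>p\<close> to the generator of the
  homology of \<open>(X, X - {p})\<close> given by positively oriented simplices around \<open>p\<close>.\<close>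

definition is_fundamental_class ::
    "nat \<Rightarrow> 'a topology \<Rightarrow> ('a, 'e::euclidean_space) chart set \<Rightarrow>
     (('a, 'e) chart \<Rightarrow> 'e \<Rightarrow> (nat \<Rightarrow> 'e) \<Rightarrow> bool) \<Rightarrow> 'a chain set \<Rightarrow> bool" where
  "is_fundamental_class n X \<A> pos \<mu> \<longleftrightarrow>
     \<mu> \<in> carrier (homology_group (int n) X) \<and>
     (\<forall>c\<in>\<A>. \<forall>p\<in>fst c. \<forall>v.
        pos c (snd c p) v \<and> convex hull (v ` {..n}) \<subseteq> snd c ` fst c \<and>
        snd c p \<in> interior (convex hull (v ` {..n})) \<longrightarrow>
        (\<forall>z\<in>\<mu>. homologous_rel n X (topspace X - {p}) z (frag_of (chart_simplex c n v))))"

text \<open>The orientation of an almost complex 4-manifold: bases \<open>a, J a, b, J b\<close> are positive.\<close>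

definition acs_positive ::
    "'a almost_complex \<Rightarrow> ('a, real^4) chart \<Rightarrow> real^4 \<Rightarrow> (nat \<Rightarrow> real^4) \<Rightarrow> bool" where
  "acs_positive X c x v \<longleftrightarrow>
     (\<exists>a b. 0 < det (vector [v 1 - v 0, v 2 - v 0, v 3 - v 0, v 4 - v 0] :: real^4^4) *
               det (vector [a, acs X c x a, b, acs X c x b] :: real^4^4))"

definition is_M_class :: "'a almost_complex \<Rightarrow> 'a chain set \<Rightarrow> bool" where
  "is_M_class X \<mu> \<longleftrightarrow> is_fundamental_class 4 (actop X) (atlas X) (acs_positive X) \<mu>"

section \<open>The intersection form\<close>

abbreviation H2 :: "'a almost_complex \<Rightarrow> 'a chain set monoid" where
  "H2 X \<equiv> homology_group 2 (actop X)"

text \<open>Integral singular cochains are functions on singular simplices.\<close>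

definition eval_cochain :: "(((nat \<Rightarrow> real) \<Rightarrow> 'a) \<Rightarrow> int) \<Rightarrow> 'a chain \<Rightarrow> int" where
  "eval_cochain \<beta> z = (\<Sum>\<sigma>\<in>Poly_Mapping.keys z. Poly_Mapping.lookup z \<sigma> * \<beta> \<sigma>)"

definition cocycle :: "nat \<Rightarrow> 'a topology \<Rightarrow> (((nat \<Rightarrow> real) \<Rightarrow> 'a) \<Rightarrow> int) \<Rightarrow> bool" where
  "cocycle k X \<beta> \<longleftrightarrow>
     (\<forall>z. singular_chain (Suc k) X z \<longrightarrow> eval_cochain \<beta> (chain_boundary (Suc k) z) = 0)"

definition front_face :: "nat \<Rightarrow> ((nat \<Rightarrow> real) \<Rightarrow> 'a) \<Rightarrow> (nat \<Rightarrow> real) \<Rightarrow> 'a" where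
  "front_face k \<sigma> = restrict \<sigma> (standard_simplex k)"

definition back_face :: "nat \<Rightarrow> nat \<Rightarrow> ((nat \<Rightarrow> real) \<Rightarrow> 'a) \<Rightarrow> (nat \<Rightarrow> real) \<Rightarrow> 'a" where
  "back_face k l \<sigma> = restrict (\<lambda>t. \<sigma> (\<lambda>i. if i < k then 0 else t (i - k))) (standard_simplex l)"

text \<open>Cap product of a \<open>(k + l)\<close>-chain with a \<open>k\<close>-cochain.\<close>

definition cap :: "nat \<Rightarrow> nat \<Rightarrow> 'a chain \<Rightarrow> (((nat \<Rightarrow> real) \<Rightarrow> 'a) \<Rightarrow> int) \<Rightarrow> 'a chain" where
  "cap k l z \<beta> =
     frag_extend (\<lambda>\<sigma>. frag_cmul (\<beta> (front_face k \<sigma>)) (frag_of (back_face k l \<sigma>))) z"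

text \<open>The intersection form is the biadditive form on \<open>H2 X\<close> whose value on \<open>a\<close> and
  \<open>[M] \<inter> \<beta>\<close> is \<open>\<beta>(a)\<close>. By Poincare duality every class is of the form \<open>[M] \<inter> \<beta>\<close>, so there is
  exactly one such form on a closed almost complex 4-manifold.\<close>

definition is_intersection_form ::
    "'a almost_complex \<Rightarrow> ('a chain set \<Rightarrow> 'a chain set \<Rightarrow> int) \<Rightarrow> bool" where
  "is_intersection_form X Q \<longleftrightarrow>
     (\<forall>b\<in>carrier (H2 X). (\<lambda>a. Q a b) \<in> hom (H2 X) integer_group) \<and>
     (\<forall>a\<in>carrier (H2 X). Q a \<in> hom (H2 X) integer_group) \<and>
     (\<forall>\<mu>. is_M_class X \<mu> \<longrightarrow>
        (\<forall>m\<in>\<mu>. \<forall>\<beta>. cocycle 2 (actop X) \<beta> \<longrightarrow>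
          (\<forall>a\<in>carrier (H2 X). \<forall>z\<in>a.
             Q a (homologous_rel_set 2 (actop X) {} (cap 2 2 m \<beta>)) = eval_cochain \<beta> z)))"

text \<open>The default value \<open>0\<close> is never taken on a closed almost complex 4-manifold.\<close>

definition intersection :: "'a almost_complex \<Rightarrow> 'a chain set \<Rightarrow> 'a chain set \<Rightarrow> int" where
  "intersection X =
     (if \<exists>Q. is_intersection_form X Q then SOME Q. is_intersection_form X Q else (\<lambda>_ _. 0))"

section \<open>The canonical class\<close>

text \<open>Points of the canonical bundle \<open>\<Lambda>\<^sup>2\<^sup>,\<^sup>0\<close> over \<open>p\<close>, other than zero: alternating bilinear forms
  with \<open>\<eta>(J v, w) = \<i> \<eta>(v, w)\<close> on the tangent space at \<open>p\<close>, given by their expressions \<open>\<eta> c\<close> in the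
  charts \<open>c\<close> around \<open>p\<close>.\<close>

definition nonzero_20_form ::
    "'a almost_complex \<Rightarrow> 'a \<Rightarrow> (('a, real^4) chart \<Rightarrow> real^4 \<Rightarrow> real^4 \<Rightarrow> complex) \<Rightarrow> bool" where
  "nonzero_20_form X p \<eta> \<longleftrightarrow>
     (\<forall>c\<in>atlas X. p \<in> fst c \<longrightarrow>
        bilinear (\<eta> c) \<and> (\<forall>v. \<eta> c v v = 0) \<and>
        (\<forall>v w. \<eta> c (acs X c (snd c p) v) w = \<i> * \<eta> c v w) \<and>
        (\<exists>v w. \<eta> c v w \<noteq> 0) \<and>
        (\<forall>c'\<in>atlas X. p \<in> fst c' \<longrightarrow>
           (\<forall>v w. \<eta> c v w =
              \<eta> c' (frechet_derivative (coord_change c c') (at (snd c p)) v)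
                   (frechet_derivative (coord_change c c') (at (snd c p)) w))))"

text \<open>Nowhere vanishing continuous sections of the pullback of the canonical bundle along a
  singular \<open>k\<close>-simplex.\<close>

definition canonical_section ::
    "'a almost_complex \<Rightarrow> nat \<Rightarrow> ((nat \<Rightarrow> real) \<Rightarrow> 'a) \<Rightarrow>
     ((nat \<Rightarrow> real) \<Rightarrow> ('a, real^4) chart \<Rightarrow> real^4 \<Rightarrow> real^4 \<Rightarrow> complex) \<Rightarrow> bool" where
  "canonical_section X k \<sigma> s \<longleftrightarrow>
     (\<forall>t\<in>standard_simplex k. nonzero_20_form X (\<sigma> t) (s t)) \<and>
     (\<forall>c\<in>atlas X. \<forall>v w.
        continuous_on {t \<in> standard_simplex k. \<sigma> t \<in> fst c} (\<lambda>t. s t c v w))"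

definition edge_point :: "real \<Rightarrow> nat \<Rightarrow> real" where
  "edge_point x i = (if i = 0 then 1 - x else if i = 1 then x else 0)"

text \<open>The canonical class is the first Chern class of the canonical bundle, i.e. the primary
  obstruction to a nowhere vanishing section. Given nowhere vanishing sections \<open>s0\<close> over the
  points and \<open>s1\<close> over the singular 1-simplices extending \<open>s0\<close>, the obstruction cocycle takes on
  a singular 2-simplex \<open>\<sigma>\<close> the winding number along the boundary (from vertex 0 to 1 to 2 to 0)
  of \<open>s1\<close> relative to a nowhere vanishing section \<open>u\<close> over \<open>\<sigma>\<close>; it does not depend on \<open>u\<close>. Here
  \<open>h k\<close> is the ratio of \<open>s1\<close> and \<open>u\<close> on the face opposite to vertex \<open>k\<close>.\<close>

definition canonical_cocycle ::
    "'a almost_complex \<Rightarrow> (((nat \<Rightarrow> real) \<Rightarrow> 'a) \<Rightarrow> int) \<Rightarrow> bool" where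
  "canonical_cocycle X \<kappa> \<longleftrightarrow>
     (\<exists>s0 s1.
        (\<forall>p\<in>topspace (actop X). nonzero_20_form X p (s0 p)) \<and>
        (\<forall>\<gamma>. singular_simplex 1 (actop X) \<gamma> \<longrightarrow>
           canonical_section X 1 \<gamma> (s1 \<gamma>) \<and>
           (\<forall>x\<in>{0,1}. \<forall>c\<in>atlas X. \<gamma> (edge_point x) \<in> fst c \<longrightarrow>
              s1 \<gamma> (edge_point x) c = s0 (\<gamma> (edge_point x)) c)) \<and>
        (\<forall>\<sigma>. singular_simplex 2 (actop X) \<sigma> \<longrightarrow>
           (\<forall>u h.
              canonical_section X 2 \<sigma> u \<and>
              (\<forall>k\<le>2. \<forall>x\<in>{0..1}. \<forall>c\<in>atlas X.
                 \<sigma> (simplical_face k (edge_point x)) \<in> fst c \<longrightarrow>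
                 (\<forall>v w. s1 (singular_face 2 k \<sigma>) (edge_point x) c v w =
                        h k x * u (simplical_face k (edge_point x)) c v w)) \<longrightarrow>
              of_int (\<kappa> \<sigma>) = winding_number (h 2 +++ (h 0 +++ reversepath (h 1))) 0)))"

definition canonical_pairing :: "'a almost_complex \<Rightarrow> 'a chain set \<Rightarrow> int" where
  "canonical_pairing X e =
     (THE k. \<exists>\<kappa> z. canonical_cocycle X \<kappa> \<and> z \<in> e \<and> k = eval_cochain \<kappa> z)"

section \<open>J-holomorphic subvarieties\<close>

text \<open>The Hausdorff measure depends on the choice of a Riemannian distance, but its being finite or
  nonzero does not. As distances we allow all metrics inducing the topology that are locally
  bi-Lipschitz to the Euclidean distance in charts; Riemannian distances are of this kind, and on a
  compact manifold all of them give the same notion. The dimensional normalizing constant is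
  omitted.\<close>

definition compatible_distance :: "'a almost_complex \<Rightarrow> ('a \<Rightarrow> 'a \<Rightarrow> real) \<Rightarrow> bool" where
  "compatible_distance X d \<longleftrightarrow>
     Metric_space (topspace (actop X)) d \<and>
     Metric_space.mtopology (topspace (actop X)) d = actop X \<and>
     (\<forall>c\<in>atlas X. \<forall>p\<in>fst c. \<exists>V L. openin (actop X) V \<and> p \<in> V \<and> V \<subseteq> fst c \<and> L > 0 \<and>
        (\<forall>x\<in>V. \<forall>y\<in>V. dist (snd c x) (snd c y) \<le> L * d x y \<and>
                      d x y \<le> L * dist (snd c x) (snd c y)))"

definition ediameter :: "('a \<Rightarrow> 'a \<Rightarrow> real) \<Rightarrow> 'a set \<Rightarrow> ennreal" where
  "ediameter d U = (SUP x\<in>U. SUP y\<in>U. ennreal (d x y))"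

definition hausdorff_measure_2 :: "'a set \<Rightarrow> ('a \<Rightarrow> 'a \<Rightarrow> real) \<Rightarrow> 'a set \<Rightarrow> ennreal" where
  "hausdorff_measure_2 S d C =
     (SUP \<delta>\<in>{0<..}. INF U\<in>{U :: nat \<Rightarrow> 'a set. C \<subseteq> (\<Union>i. U i) \<and>
         (\<forall>i. U i \<subseteq> S \<and> ediameter d (U i) \<le> ennreal \<delta>)}. suminf (\<lambda>i. (ediameter d (U i))\<^sup>2))"

definition J_invariant_submanifold :: "'a almost_complex \<Rightarrow> 'a set \<Rightarrow> bool" where
  "J_invariant_submanifold X N \<longleftrightarrow> N \<subseteq> topspace (actop X) \<and>
     (\<forall>p\<in>N. \<exists>c\<in>atlas X. p \<in> fst c \<and>
        (\<exists>V. subspace V \<and> snd c ` (fst c \<inter> N) = (snd c ` fst c) \<inter> V \<and>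
             (\<forall>x\<in>snd c ` (fst c \<inter> N). acs X c x ` V \<subseteq> V)))"

definition irreducible_subvariety :: "'a almost_complex \<Rightarrow> 'a set \<Rightarrow> bool" where
  "irreducible_subvariety X C \<longleftrightarrow>
     closedin (actop X) C \<and>
     (\<exists>d. compatible_distance X d \<and>
          0 < hausdorff_measure_2 (topspace (actop X)) d C \<and>
          hausdorff_measure_2 (topspace (actop X)) d C < \<infinity>) \<and>
     C \<subseteq> actop X derived_set_of C \<and>
     (\<exists>F. finite F \<and> F \<subseteq> C \<and> connectedin (actop X) (C - F) \<and> J_invariant_submanifold X (C - F))"

text \<open>Complex curves: connected Riemann surfaces, given by a holomorphic atlas.\<close>

definition compact_complex_curve :: "'b topology \<Rightarrow> ('b, complex) chart set \<Rightarrow> bool" where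
  "compact_complex_curve S \<B> \<longleftrightarrow>
     topspace S \<noteq> {} \<and> compact_space S \<and> Hausdorff_space S \<and> connected_space S \<and>
     (\<forall>b\<in>\<B>. is_chart S b) \<and> (\<Union>b\<in>\<B>. fst b) = topspace S \<and>
     (\<forall>b\<in>\<B>. \<forall>b'\<in>\<B>. coord_change b b' holomorphic_on snd b ` (fst b \<inter> fst b'))"

definition complex_positive :: "('b, complex) chart \<Rightarrow> complex \<Rightarrow> (nat \<Rightarrow> complex) \<Rightarrow> bool" where
  "complex_positive b x v \<longleftrightarrow> 0 < Im (cnj (v 1 - v 0) * (v 2 - v 0))"

definition local_expr ::
    "('b, complex) chart \<Rightarrow> ('a, real^4) chart \<Rightarrow> ('b \<Rightarrow> 'a) \<Rightarrow> complex \<Rightarrow> real^4" where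
  "local_expr b c f = snd c \<circ> f \<circ> chart_inv b"

definition J_holomorphic_map ::
    "'b topology \<Rightarrow> ('b, complex) chart set \<Rightarrow> 'a almost_complex \<Rightarrow> ('b \<Rightarrow> 'a) \<Rightarrow> bool" where
  "J_holomorphic_map S \<B> X f \<longleftrightarrow>
     continuous_map S (actop X) f \<and>
     (\<forall>b\<in>\<B>. \<forall>c\<in>atlas X. let D = snd b ` {q \<in> fst b. f q \<in> fst c}; g = local_expr b c f in
        smooth_on D g \<and>
        (\<forall>x\<in>D. \<forall>w. frechet_derivative g (at x) (\<i> * w) =
                   acs X c (g x) (frechet_derivative g (at x) w)))"

definition embedding_off ::
    "'b topology \<Rightarrow> ('b, complex) chart set \<Rightarrow> 'a almost_complex \<Rightarrow> ('b \<Rightarrow> 'a) \<Rightarrow> 'b set \<Rightarrow> bool" where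
  "embedding_off S \<B> X f F \<longleftrightarrow>
     embedding_map (subtopology S (topspace S - F)) (actop X) f \<and>
     (\<forall>b\<in>\<B>. \<forall>c\<in>atlas X. \<forall>q\<in>fst b - F. f q \<in> fst c \<longrightarrow>
        inj (frechet_derivative (local_expr b c f) (at (snd b q))))"

text \<open>The class \<open>e\<^sub>C\<close> of an irreducible subvariety \<open>C\<close>. Every complex curve has the cardinality of the
  continuum, so it is no loss of generality to take one whose underlying set consists of real
  numbers (the topology \<open>S\<close> is unrelated to the one of \<open>real\<close>).\<close>

definition is_curve_class :: "'a almost_complex \<Rightarrow> 'a set \<Rightarrow> 'a chain set \<Rightarrow> bool" where
  "is_curve_class X C e \<longleftrightarrow>
     (\<exists>(S :: real topology) \<B> f F \<mu>.
        compact_complex_curve S \<B> \<and> J_holomorphic_map S \<B> X f \<and> f ` topspace S = C \<and>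
        finite F \<and> embedding_off S \<B> X f F \<and>
        is_fundamental_class 2 S \<B> complex_positive \<mu> \<and>
        e = hom_induced 2 S {} (actop X) {} f \<mu>)"

definition curve_class :: "'a almost_complex \<Rightarrow> 'a set \<Rightarrow> 'a chain set" where
  "curve_class X C = (THE e. is_curve_class X C e)"

definition subvariety :: "'a almost_complex \<Rightarrow> ('a set \<times> nat) set \<Rightarrow> bool" where
  "subvariety X \<Theta> \<longleftrightarrow> finite \<Theta> \<and> inj_on fst \<Theta> \<and>
     (\<forall>(C, m)\<in>\<Theta>. irreducible_subvariety X C \<and> m > 0)"

definition subvariety_class :: "'a almost_complex \<Rightarrow> ('a set \<times> nat) set \<Rightarrow> 'a chain set" where
  "subvariety_class X \<Theta> = finprod (H2 X) (\<lambda>(C, m). curve_class X C [^]\<^bsub>H2 X\<^esub> m) \<Theta>"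

definition J_effective :: "'a almost_complex \<Rightarrow> 'a chain set \<Rightarrow> bool" where
  "J_effective X e \<longleftrightarrow>
     e \<in> carrier (H2 X) \<and> (\<exists>\<Theta>. subvariety X \<Theta> \<and> e = subvariety_class X \<Theta>)"

definition J_nef :: "'a almost_complex \<Rightarrow> 'a chain set \<Rightarrow> bool" where
  "J_nef X e \<longleftrightarrow>
     e \<in> carrier (H2 X) \<and> (\<forall>e'. J_effective X e' \<longrightarrow> 0 \<le> intersection X e e')"

section \<open>Numerical invariants of classes\<close>

definition adj :: "'a almost_complex \<Rightarrow> 'a chain set \<Rightarrow> int" where
  "adj X e = intersection X e e + canonical_pairing X e"

definition J_genus :: "'a almost_complex \<Rightarrow> 'a chain set \<Rightarrow> real" where
  "J_genus X e = of_int (adj X e) / 2 + 1"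

definition iota :: "'a almost_complex \<Rightarrow> 'a chain set \<Rightarrow> real" where
  "iota X e = of_int (intersection X e e - canonical_pairing X e) / 2"

definition class_dim :: "'a almost_complex \<Rightarrow> 'a chain set \<Rightarrow> real" where
  "class_dim X e = max (iota X e) 0"

section \<open>Weighted graphs\<close>

text \<open>Edges and their labels are determined by the weights of the vertices, see \<open>graph_edge\<close> and
  \<open>edge_label\<close>.\<close>

record ('v, 'a) weighted_graph =
  verts :: "'v set"
  cls :: "'v \<Rightarrow> 'a chain set"
  mult :: "'v \<Rightarrow> nat"

definition weighted_graph :: "'a almost_complex \<Rightarrow> ('v, 'a) weighted_graph \<Rightarrow> bool" where
  "weighted_graph X G \<longleftrightarrow>
     finite (verts G) \<and> (\<forall>v\<in>verts G. J_effective X (cls G v) \<and> mult G v > 0)"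

definition edge_label :: "'a almost_complex \<Rightarrow> ('v, 'a) weighted_graph \<Rightarrow> 'v \<Rightarrow> 'v \<Rightarrow> int" where
  "edge_label X G u v = intersection X (cls G u) (cls G v)"

definition graph_edge :: "'a almost_complex \<Rightarrow> ('v, 'a) weighted_graph \<Rightarrow> 'v \<Rightarrow> 'v \<Rightarrow> bool" where
  "graph_edge X G u v \<longleftrightarrow>
     u \<in> verts G \<and> v \<in> verts G \<and> u \<noteq> v \<and> edge_label X G u v \<noteq> 0"

definition connected_graph :: "'a almost_complex \<Rightarrow> ('v, 'a) weighted_graph \<Rightarrow> bool" where
  "connected_graph X G \<longleftrightarrow> (\<forall>u\<in>verts G. \<forall>v\<in>verts G. (graph_edge X G)\<^sup>*\<^sup>* u v)"

definition total_class :: "'a almost_complex \<Rightarrow> ('v, 'a) weighted_graph \<Rightarrow> 'a chain set" where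
  "total_class X G = finprod (H2 X) (\<lambda>v. cls G v [^]\<^bsub>H2 X\<^esub> mult G v) (verts G)"

definition curve_configuration :: "'a almost_complex \<Rightarrow> ('v, 'a) weighted_graph \<Rightarrow> bool" where
  "curve_configuration X G \<longleftrightarrow> weighted_graph X G \<and>
     (\<forall>v\<in>verts G. adj X (cls G v) \<ge> -2) \<and>
     (\<forall>u v. graph_edge X G u v \<longrightarrow> edge_label X G u v > 0)"

definition graph_dim :: "'a almost_complex \<Rightarrow> ('v, 'a) weighted_graph \<Rightarrow> real" where
  "graph_dim X G = (\<Sum>v\<in>verts G. class_dim X (cls G v))"

end

theory Submission
  imports Defs
begin

text \<open>
  Write \<open>n\<^sub>v = e \<cdot> e\<^sub>v\<close> for a vertex \<open>v\<close> of \<open>G\<close>. The genus condition says \<open>K \<cdot> e = - 2 - e \<cdot> e\<close>, so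
  \<open>\<iota>\<^sub>e = e \<cdot> e + 1\<close>, and the claim becomes \<open>\<Sum>\<^sub>v l\<^sub>v \<le> e \<cdot> e = \<Sum>\<^sub>v m\<^sub>v n\<^sub>v\<close>. This already holds vertex by
  vertex, that is, \<open>l\<^sub>v \<le> m\<^sub>v n\<^sub>v\<close>. The right-hand side is nonnegative because \<open>e\<close> is nef, which settles
  the vertices with \<open>l\<^sub>v = 0\<close>. If \<open>l\<^sub>v > 0\<close>, then \<open>adj(e\<^sub>v) \<ge> - 2\<close> gives \<open>l\<^sub>v \<le> e\<^sub>v \<cdot> e\<^sub>v + 1\<close>, so the integer
  \<open>e\<^sub>v \<cdot> e\<^sub>v\<close> is nonnegative. As \<open>G\<close> is connected with at least two vertices, some \<open>e\<^sub>u\<close> with \<open>u \<noteq> v\<close>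
  satisfies \<open>e\<^sub>u \<cdot> e\<^sub>v \<ge> 1\<close>, and all other terms of \<open>n\<^sub>v = \<Sum>\<^sub>u m\<^sub>u (e\<^sub>u \<cdot> e\<^sub>v)\<close> are nonnegative; therefore
  \<open>n\<^sub>v \<ge> e\<^sub>v \<cdot> e\<^sub>v + 1 \<ge> l\<^sub>v\<close>.

  The intersection form enters the proof through its additivity in each argument, which expands
  \<open>e \<cdot> e\<close> and \<open>n\<^sub>v\<close> along \<open>e = \<Sum>\<^sub>v m\<^sub>v e\<^sub>v\<close>.
\<close>

lemma comm_group_H2: "comm_group (H2 X)"
  by (rule abelian_homology_group)

lemma integer_hom_finprod_pow:
  fixes m :: "'v \<Rightarrow> nat"
  assumes G: "comm_group G" and h: "h \<in> hom G integer_group"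
    and A: "finite A" and f: "f \<in> A \<rightarrow> carrier G"
  shows "h (finprod G (\<lambda>v. f v [^]\<^bsub>G\<^esub> m v) A) = (\<Sum>v\<in>A. int (m v) * h (f v))"
proof -
  interpret comm_group G by fact
  interpret h: group_hom G integer_group h
    using h by (intro group_hom.intro group_hom_axioms.intro group_integer_group is_group)
  have pow: "h (x [^]\<^bsub>G\<^esub> n) = int n * h x" if "x \<in> carrier G" for x and n :: nat
    using that by (induction n) (simp_all add: algebra_simps)
  show ?thesis
    using A f
  proof (induction A rule: finite_induct)
    case empty
    show ?case by simp
  next
    case (insert v A)
    then have "f v \<in> carrier G" and A: "f \<in> A \<rightarrow> carrier G" by auto
    then have "(\<lambda>v. f v [^]\<^bsub>G\<^esub> m v) \<in> A \<rightarrow> carrier G" by auto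
    then show ?case
      using insert.hyps insert.IH[OF A] \<open>f v \<in> carrier G\<close> by (simp add: pow)
  qed
qed

text \<open>Additivity is part of the characterisation of an intersection form, and the default value \<open>0\<close>
  is additive as well.\<close>

lemma intersection_hom_left:
  assumes "b \<in> carrier (H2 X)"
  shows "(\<lambda>a. intersection X a b) \<in> hom (H2 X) integer_group"
proof (cases "\<exists>Q. is_intersection_form X Q")
  case True
  then have "is_intersection_form X (intersection X)"
    by (simp add: intersection_def someI_ex)
  then show ?thesis
    using assms by (simp add: is_intersection_form_def)
qed (simp add: intersection_def hom_def)

lemma intersection_hom_right:
  assumes "a \<in> carrier (H2 X)"
  shows "intersection X a \<in> hom (H2 X) integer_group"
proof (cases "\<exists>Q. is_intersection_form X Q")
  case True
  then have "is_intersection_form X (intersection X)"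
    by (simp add: intersection_def someI_ex)
  then show ?thesis
    using assms by (simp add: is_intersection_form_def)
qed (simp add: intersection_def hom_def)

lemma weighted_graph_cls_carrier:
  "weighted_graph X G \<Longrightarrow> cls G \<in> verts G \<rightarrow> carrier (H2 X)"
  by (auto simp: weighted_graph_def J_effective_def)

lemma intersection_total_class_left:
  assumes "weighted_graph X G" and "b \<in> carrier (H2 X)"
  shows "intersection X (total_class X G) b =
           (\<Sum>u\<in>verts G. int (mult G u) * intersection X (cls G u) b)"
  unfolding total_class_def
  using assms(1)
  by (intro integer_hom_finprod_pow[OF comm_group_H2 intersection_hom_left[OF assms(2)]]
        weighted_graph_cls_carrier)
    (simp_all add: weighted_graph_def)

lemma intersection_total_class_right:
  assumes "weighted_graph X G" and "a \<in> carrier (H2 X)"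
  shows "intersection X a (total_class X G) =
           (\<Sum>v\<in>verts G. int (mult G v) * intersection X a (cls G v))"
  unfolding total_class_def
  using assms(1)
  by (intro integer_hom_finprod_pow[OF comm_group_H2 intersection_hom_right[OF assms(2)]]
        weighted_graph_cls_carrier)
    (simp_all add: weighted_graph_def)

lemma connected_graph_obtain_in_edge:
  assumes "connected_graph X G" and "card (verts G) \<ge> 2" and v: "v \<in> verts G"
  obtains u where "graph_edge X G u v"
proof -
  have "\<not> verts G \<subseteq> {v}"
    using assms(2) card_mono[of "{v}" "verts G"] by auto
  then obtain w where "w \<in> verts G" "w \<noteq> v" by auto
  then have "(graph_edge X G)\<^sup>*\<^sup>* w v"
    using assms(1) v by (simp add: connected_graph_def)
  then show thesis
    using \<open>w \<noteq> v\<close> that by (auto elim: rtranclp.cases)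
qed

text \<open>A vertex of nonnegative self-intersection meets the total class in its own contribution,
  counted \<open>m\<^sub>v \<ge> 1\<close> times, and in at least one neighbour.\<close>

lemma self_intersection_less_total_class:
  assumes conf: "curve_configuration X G" and conn: "connected_graph X G"
    and two: "card (verts G) \<ge> 2" and v: "v \<in> verts G"
    and nonneg: "intersection X (cls G v) (cls G v) \<ge> 0"
  shows "intersection X (cls G v) (cls G v) + 1 \<le> intersection X (total_class X G) (cls G v)"
proof -
  define q where "q u = intersection X (cls G u) (cls G v)" for u
  have wg: "weighted_graph X G"
    and pos: "\<And>u w. graph_edge X G u w \<Longrightarrow> edge_label X G u w > 0"
    using conf by (auto simp: curve_configuration_def)
  have fin: "finite (verts G)" and mult: "\<And>u. u \<in> verts G \<Longrightarrow> mult G u > 0"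
    using wg by (auto simp: weighted_graph_def)
  obtain w where w: "graph_edge X G w v"
    using connected_graph_obtain_in_edge[OF conn two v] .
  then have w': "w \<in> verts G" "w \<noteq> v" by (auto simp: graph_edge_def)
  have q_nonneg: "q u \<ge> 0" if "u \<in> verts G" for u
    using pos[of u v] that v nonneg
    by (cases "u = v \<or> q u = 0") (auto simp: q_def graph_edge_def edge_label_def)
  have le: "q u \<le> int (mult G u) * q u" if "u \<in> verts G" for u
    using mult_right_mono[of 1 "int (mult G u)" "q u"] mult[OF that] q_nonneg[OF that] by auto
  have "q v + 1 \<le> q v + q w"
    using pos[OF w] by (simp add: q_def edge_label_def)
  also have "\<dots> = (\<Sum>u\<in>{v, w}. q u)"
    using w' by simp
  also have "\<dots> \<le> (\<Sum>u\<in>verts G. q u)"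
    using fin v w' q_nonneg by (intro sum_mono2) auto
  also have "\<dots> \<le> (\<Sum>u\<in>verts G. int (mult G u) * q u)"
    using le by (intro sum_mono) auto
  also have "\<dots> = intersection X (total_class X G) (cls G v)"
    using intersection_total_class_left[OF wg] weighted_graph_cls_carrier[OF wg] v
    by (auto simp: q_def Pi_iff)
  finally show ?thesis by (simp add: q_def)
qed

lemma iota_le_self_intersection:
  assumes "adj X c \<ge> -2"
  shows "iota X c \<le> of_int (intersection X c c) + 1"
  using assms by (simp add: adj_def iota_def field_simps)

lemma iota_genus_zero:
  assumes "J_genus X e = 0"
  shows "iota X e = of_int (intersection X e e) + 1"
  using assms by (simp add: J_genus_def adj_def iota_def field_simps)

text \<open>The vertexwise estimate \<open>l\<^sub>v \<le> m\<^sub>v n\<^sub>v\<close>: nefness covers the rigid vertices, and the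
  neighbours supply the summand \<open>1\<close> for the others.\<close>

lemma class_dim_vertex_le:
  assumes conf: "curve_configuration X G" and conn: "connected_graph X G"
    and two: "card (verts G) \<ge> 2" and nef: "J_nef X (total_class X G)" and v: "v \<in> verts G"
  shows "class_dim X (cls G v) \<le>
           of_int (int (mult G v) * intersection X (total_class X G) (cls G v))"
proof -
  define q where "q = intersection X (cls G v) (cls G v)"
  define n where "n = intersection X (total_class X G) (cls G v)"
  have adj: "adj X (cls G v) \<ge> -2" and mult: "mult G v > 0" and eff: "J_effective X (cls G v)"
    using conf v by (auto simp: curve_configuration_def weighted_graph_def)
  have "0 \<le> n"
    using nef eff by (simp add: J_nef_def n_def)
  have iota: "iota X (cls G v) \<le> of_int (q + 1)"
    using iota_le_self_intersection[OF adj] by (simp add: q_def)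
  have "class_dim X (cls G v) \<le> of_int n"
  proof (cases "q \<ge> 0")
    case True
    then have "q + 1 \<le> n"
      using self_intersection_less_total_class[OF conf conn two v] by (simp add: q_def n_def)
    then have "iota X (cls G v) \<le> of_int n"
      using iota by linarith
    with \<open>0 \<le> n\<close> show ?thesis by (simp add: class_dim_def)
  next
    \<comment> \<open>Integrality of \<open>q\<close> turns \<open>q < 0\<close> into \<open>q + 1 \<le> 0\<close>.\<close>
    case False
    then have "iota X (cls G v) \<le> 0"
      using iota by linarith
    with \<open>0 \<le> n\<close> show ?thesis by (simp add: class_dim_def)
  qed
  also have "n \<le> int (mult G v) * n"
    using mult_right_mono[of 1 "int (mult G v)" n] mult \<open>0 \<le> n\<close> by simp
  finally show ?thesis by (simp add: n_def)
qed

theorem corollary4p11: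
  fixes X :: "'a almost_complex" and e :: "'a chain set"
    and G :: "('v, 'a) weighted_graph" and L :: real
  assumes "closed_connected_almost_complex_4_manifold X"
    and "J_nef X e" and "J_genus X e = 0" and "L = class_dim X e"
    and "curve_configuration X G" and "connected_graph X G"
    and "total_class X G = e" and "card (verts G) \<ge> 2"
  shows "graph_dim X G \<le> L - 1"
proof -
  have wg: "weighted_graph X G"
    using assms(5) by (simp add: curve_configuration_def)
  have "e \<in> carrier (H2 X)"
    using assms(2) by (simp add: J_nef_def)
  have "graph_dim X G \<le> (\<Sum>v\<in>verts G. of_int (int (mult G v) * intersection X e (cls G v)))"
    unfolding graph_dim_def
    using class_dim_vertex_le[OF assms(5,6,8)] assms(2,7) by (intro sum_mono) blast
  also have "\<dots> = of_int (intersection X e e)"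
    using intersection_total_class_right[OF wg \<open>e \<in> carrier (H2 X)\<close>] assms(7) by simp
  also have "\<dots> \<le> L - 1"
    using iota_genus_zero[OF assms(3)] assms(4) by (simp add: class_dim_def)
  finally show ?thesis .
qed

end
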